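(* Let $p>3$ be a prime and let $x$ be a $p$-adic integer with $x\equiv-2k\pmod p$ for some $k\in\{1,\ldots,\lfloor(p-1)/3\rfloor\}$. Then $$\sum_{r=0}^{p-1}(-1)^r\binom xr^3\equiv0\pmod{p^2}.$$
   Context: For a $p$-adic integer $x$ and an integer $r\ge0$, $\binom xr=x(x-1)\cdots(x-r+1)/r!$, which is a $p$-adic integer. Congruences are in the ring of $p$-adic integers. *)

theory Defs
  imports
    "HOL-Algebra.Algebra"
    "HOL-Computational_Algebra.Primes"
begin

hide_const (open) Divisibility.prime

text \<open>
  The ring of \<open>p\<close>-adic integers as the inverse limit of the rings \<open>\<int>/p\<^sup>n\<int>\<close>: an element is a
  sequence \<open>f\<close> with \<open>f n\<close> the canonical representative modulo \<open>p\<^sup>n\<close> (so \<open>f 0 = 0\<close>).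
\<close>

definition padic_int_ring :: "nat \<Rightarrow> (nat \<Rightarrow> int) ring" where
  "padic_int_ring p =
     \<lparr>carrier = {f. \<forall>n. f n \<in> {0..<int p ^ n} \<and> f (Suc n) mod int p ^ n = f n},
      monoid.mult = (\<lambda>f g n. (f n * g n) mod int p ^ n),
      monoid.one = (\<lambda>n. 1 mod int p ^ n),
      ring.zero = (\<lambda>n. 0),
      ring.add = (\<lambda>f g n. (f n + g n) mod int p ^ n)\<rparr>"

abbreviation padic_of_int :: "nat \<Rightarrow> int \<Rightarrow> nat \<Rightarrow> int" where
  "padic_of_int p k \<equiv> [k] \<cdot>\<^bsub>padic_int_ring p\<^esub> \<one>\<^bsub>padic_int_ring p\<^esub>"

definition padic_cong :: "nat \<Rightarrow> int \<Rightarrow> (nat \<Rightarrow> int) \<Rightarrow> (nat \<Rightarrow> int) \<Rightarrow> bool" where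
  "padic_cong p m a b \<longleftrightarrow>
     padic_of_int p m divides\<^bsub>padic_int_ring p\<^esub> (a \<ominus>\<^bsub>padic_int_ring p\<^esub> b)"

text \<open>
  The quotient \<open>x(x - 1)\<dots>(x - r + 1)/r!\<close> is taken inside \<open>\<int>\<^sub>p\<close>, where \<open>r!\<close> need not be
  invertible; lemma \<open>padic_binom_ex1\<close> below shows that it exists and is unique for every
  prime \<open>p\<close>, every \<open>p\<close>-adic integer \<open>x\<close> and every \<open>r\<close>.
\<close>

definition padic_binom :: "nat \<Rightarrow> (nat \<Rightarrow> int) \<Rightarrow> nat \<Rightarrow> (nat \<Rightarrow> int)" where
  "padic_binom p x r =
     (THE b. b \<in> carrier (padic_int_ring p) \<and>
        padic_of_int p (fact r) \<otimes>\<^bsub>padic_int_ring p\<^esub> b =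
        (\<Otimes>\<^bsub>padic_int_ring p\<^esub>i\<in>{..<r}. x \<ominus>\<^bsub>padic_int_ring p\<^esub> padic_of_int p (int i)))"

lemma padic_carrier_iff:
  "f \<in> carrier (padic_int_ring p) \<longleftrightarrow>
     (\<forall>n. 0 \<le> f n \<and> f n < int p ^ n \<and> f (Suc n) mod int p ^ n = f n)"
  by (auto simp: padic_int_ring_def)

lemma padic_sel:
  "f \<otimes>\<^bsub>padic_int_ring p\<^esub> g = (\<lambda>n. (f n * g n) mod int p ^ n)"
  "f \<oplus>\<^bsub>padic_int_ring p\<^esub> g = (\<lambda>n. (f n + g n) mod int p ^ n)"
  "\<one>\<^bsub>padic_int_ring p\<^esub> = (\<lambda>n. 1 mod int p ^ n)"
  "\<zero>\<^bsub>padic_int_ring p\<^esub> = (\<lambda>n. 0)"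
  by (simp_all add: padic_int_ring_def)

lemma padic_mod_self:
  "f \<in> carrier (padic_int_ring p) \<Longrightarrow> f n mod int p ^ n = f n"
  by (simp add: padic_carrier_iff)

lemma padic_carrierI:
  assumes "p > 0" "\<And>n. g (Suc n) mod int p ^ n = g n mod int p ^ n"
  shows "(\<lambda>n. g n mod int p ^ n) \<in> carrier (padic_int_ring p)"
proof -
  have "(g (Suc n) mod int p ^ Suc n) mod int p ^ n = g n mod int p ^ n" for n
    using assms(2)[of n] by (simp add: mod_mod_cancel)
  with assms(1) show ?thesis by (simp add: padic_carrier_iff)
qed

lemma padic_Suc_mod:
  "f \<in> carrier (padic_int_ring p) \<Longrightarrow> f (Suc n) mod int p ^ n = f n mod int p ^ n"
  by (simp add: padic_carrier_iff)

lemma padic_mod_power: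
  assumes "f \<in> carrier (padic_int_ring p)" "m \<le> n"
  shows "f n mod int p ^ m = f m"
  using assms(2,1)
proof (induction n rule: dec_induct)
  case base
  then show ?case by (simp add: padic_mod_self)
next
  case (step n)
  have "f (Suc n) mod int p ^ m = (f (Suc n) mod int p ^ n) mod int p ^ m"
    using step by (simp add: mod_mod_cancel le_imp_power_dvd)
  also have "\<dots> = f m"
    using step by (simp add: padic_carrier_iff)
  finally show ?case .
qed

lemma padic_cring:
  assumes "p > 0"
  shows "cring (padic_int_ring p)"
proof (rule cringI)
  show "abelian_group (padic_int_ring p)"
  proof (rule abelian_groupI)
    fix x y assume x: "x \<in> carrier (padic_int_ring p)" and y: "y \<in> carrier (padic_int_ring p)"
    show "x \<oplus>\<^bsub>padic_int_ring p\<^esub> y \<in> carrier (padic_int_ring p)"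
      unfolding padic_sel
      by (rule padic_carrierI[OF assms]) (intro mod_add_cong padic_Suc_mod x y)
  next
    show "\<zero>\<^bsub>padic_int_ring p\<^esub> \<in> carrier (padic_int_ring p)"
      using assms by (simp add: padic_sel padic_carrier_iff)
  next
    fix x assume x: "x \<in> carrier (padic_int_ring p)"
    have "(\<lambda>n. (- x n) mod int p ^ n) \<in> carrier (padic_int_ring p)"
      by (rule padic_carrierI[OF assms]) (intro mod_minus_cong padic_Suc_mod x)
    moreover have "(\<lambda>n. (- x n) mod int p ^ n) \<oplus>\<^bsub>padic_int_ring p\<^esub> x = \<zero>\<^bsub>padic_int_ring p\<^esub>"
      by (simp add: padic_sel mod_simps)
    ultimately show "\<exists>y\<in>carrier (padic_int_ring p). y \<oplus>\<^bsub>padic_int_ring p\<^esub> x = \<zero>\<^bsub>padic_int_ring p\<^esub>"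
      by blast
  qed (auto simp: padic_sel mod_simps algebra_simps padic_mod_self)
next
  show "comm_monoid (padic_int_ring p)"
  proof (rule comm_monoidI)
    fix x y assume x: "x \<in> carrier (padic_int_ring p)" and y: "y \<in> carrier (padic_int_ring p)"
    show "x \<otimes>\<^bsub>padic_int_ring p\<^esub> y \<in> carrier (padic_int_ring p)"
      unfolding padic_sel
      by (rule padic_carrierI[OF assms]) (intro mod_mult_cong padic_Suc_mod x y)
  next
    show "\<one>\<^bsub>padic_int_ring p\<^esub> \<in> carrier (padic_int_ring p)"
      unfolding padic_sel by (rule padic_carrierI[OF assms]) simp
  qed (auto simp: padic_sel mod_simps algebra_simps padic_mod_self)
qed (auto simp: padic_sel mod_simps algebra_simps)

lemma padic_minus:
  assumes "p > 0" "x \<in> carrier (padic_int_ring p)" "y \<in> carrier (padic_int_ring p)"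
  shows "x \<ominus>\<^bsub>padic_int_ring p\<^esub> y = (\<lambda>n. (x n - y n) mod int p ^ n)"
proof -
  interpret cring "padic_int_ring p" by (rule padic_cring) fact
  have c: "(\<lambda>n. (- y n) mod int p ^ n) \<in> carrier (padic_int_ring p)"
    by (rule padic_carrierI[OF assms(1)]) (intro mod_minus_cong padic_Suc_mod assms(3))
  have "(\<lambda>n. (- y n) mod int p ^ n) \<oplus>\<^bsub>padic_int_ring p\<^esub> y = \<zero>\<^bsub>padic_int_ring p\<^esub>"
    by (simp add: padic_sel mod_simps)
  then have "\<ominus>\<^bsub>padic_int_ring p\<^esub> y = (\<lambda>n. (- y n) mod int p ^ n)"
    using c assms(3) minus_equality by auto
  then show ?thesis
    by (simp add: a_minus_def padic_sel mod_simps)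
qed

lemma padic_of_int_eq:
  assumes "p > 0"
  shows "padic_of_int p k = (\<lambda>n. k mod int p ^ n)"
proof -
  interpret cring "padic_int_ring p" by (rule padic_cring) fact
  have nat: "[m] \<cdot>\<^bsub>padic_int_ring p\<^esub> \<one>\<^bsub>padic_int_ring p\<^esub> = (\<lambda>n. int m mod int p ^ n)" for m :: nat
  proof (induction m)
    case 0
    show ?case by (simp add: add_pow_def padic_sel)
  next
    case (Suc m)
    then show ?case
      by (simp add: add.nat_pow_Suc) (simp add: padic_sel mod_simps algebra_simps)
  qed
  show ?thesis
  proof (cases "k \<ge> 0")
    case True
    then show ?thesis by (simp add: add_pow_int_ge nat)
  next
    case False
    define a where "a = [nat (- k)] \<cdot>\<^bsub>padic_int_ring p\<^esub> \<one>\<^bsub>padic_int_ring p\<^esub>"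
    have a: "a \<in> carrier (padic_int_ring p)" "a = (\<lambda>n. (- k) mod int p ^ n)"
      unfolding a_def using False by (rule_tac add.nat_pow_closed[OF one_closed], subst nat) simp
    have "\<ominus>\<^bsub>padic_int_ring p\<^esub> a = \<zero>\<^bsub>padic_int_ring p\<^esub> \<ominus>\<^bsub>padic_int_ring p\<^esub> a"
      using a(1) by (simp add: a_minus_def)
    also have "\<dots> = (\<lambda>n. (0 - a n) mod int p ^ n)"
      using padic_minus[OF assms zero_closed a(1)] by (simp add: padic_sel)
    also have "\<dots> = (\<lambda>n. k mod int p ^ n)"
      by (simp add: a(2) mod_simps)
    finally show ?thesis using False by (simp add: add_pow_int_lt a_def)
  qed
qed

lemma padic_finprod:
  assumes "p > 0" "finite A" "\<And>i. i \<in> A \<Longrightarrow> f i \<in> carrier (padic_int_ring p)"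
  shows "finprod (padic_int_ring p) f A = (\<lambda>n. (\<Prod>i\<in>A. f i n) mod int p ^ n)"
proof -
  interpret cring "padic_int_ring p" by (rule padic_cring) fact
  show ?thesis
    using assms(2,3)
  proof (induction A rule: finite_induct)
    case empty
    show ?case by (simp add: padic_sel)
  next
    case (insert a A)
    then have "finprod (padic_int_ring p) f (insert a A) =
        f a \<otimes>\<^bsub>padic_int_ring p\<^esub> finprod (padic_int_ring p) f A"
      by (intro finprod_insert) auto
    with insert show ?case by (simp add: padic_sel mod_simps)
  qed
qed

lemma padic_binom_ex1:
  assumes p: "prime p" and x: "x \<in> carrier (padic_int_ring p)"
  shows "\<exists>!b. b \<in> carrier (padic_int_ring p) \<and>
           padic_of_int p (fact r) \<otimes>\<^bsub>padic_int_ring p\<^esub> b =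
           (\<Otimes>\<^bsub>padic_int_ring p\<^esub>i\<in>{..<r}. x \<ominus>\<^bsub>padic_int_ring p\<^esub> padic_of_int p (int i))"
proof -
  have p0: "p > 0" using p by (simp add: prime_gt_0_nat)
  interpret cring "padic_int_ring p" by (rule padic_cring[OF p0])
  define rhs where
    "rhs = (\<Otimes>\<^bsub>padic_int_ring p\<^esub>i\<in>{..<r}. x \<ominus>\<^bsub>padic_int_ring p\<^esub> padic_of_int p (int i))"
  have rhs: "rhs = (\<lambda>n. (\<Prod>i<r. x n - int i) mod int p ^ n)"
  proof -
    have "rhs = (\<lambda>n. (\<Prod>i<r. (x \<ominus>\<^bsub>padic_int_ring p\<^esub> padic_of_int p (int i)) n) mod int p ^ n)"
      unfolding rhs_def by (rule padic_finprod[OF p0]) (use x in auto)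
    also have "\<dots> = (\<lambda>n. (\<Prod>i<r. (x n - int i) mod int p ^ n) mod int p ^ n)"
      using x by (simp add: padic_minus p0) (simp add: padic_of_int_eq p0 mod_simps)
    finally show ?thesis by (simp add: mod_prod_eq)
  qed
  define v where "v = multiplicity (int p) (fact r)"
  have pi: "prime (int p)" using p by simp
  obtain u where u: "fact r = int p ^ v * u" "\<not> int p dvd u"
    unfolding v_def
    by (metis fact_nonzero multiplicity_decompose' not_prime_unit pi)
  have cop: "coprime u (int p ^ n)" for n
    using u(2) pi by (metis coprime_commute coprime_power_right_iff prime_imp_coprime)
  have cancel: "int p ^ n dvd d" if "int p ^ (n + v) dvd fact r * d" for n and d :: int
  proof -
    have "int p ^ v * int p ^ n dvd int p ^ v * (u * d)"
      using that by (simp add: u(1) power_add mult_ac)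
    then have "int p ^ n dvd u * d" using p0 by simp
    then show ?thesis using cop coprime_commute coprime_dvd_mult_right_iff by blast
  qed
  define w where "w n = int (binomial (nat (x (n + v))) r)" for n
  have w: "fact r * w n = (\<Prod>i<r. x (n + v) - int i)" for n
  proof -
    define y where "y = nat (x (n + v))"
    have y: "x (n + v) = int y" using x by (simp add: y_def padic_carrier_iff)
    have "real_of_int (fact r * w n) = fact r * (real y gchoose r)"
      by (simp add: w_def y binomial_gbinomial)
    also have "\<dots> = real_of_int (\<Prod>i<r. int y - int i)"
      by (simp add: gbinomial_mult_fact atLeast0LessThan)
    finally show ?thesis unfolding y by (simp only: of_int_eq_iff)
  qed
  define b where "b = (\<lambda>n. w n mod int p ^ n)"
  have b: "b \<in> carrier (padic_int_ring p)"
    unfolding b_def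
  proof (rule padic_carrierI[OF p0])
    fix n
    have "x (Suc n + v) mod int p ^ (n + v) = x (n + v) mod int p ^ (n + v)"
      using padic_Suc_mod[OF x, of "n + v"] by simp
    then have "(\<Prod>i<r. (x (Suc n + v) - int i) mod int p ^ (n + v)) mod int p ^ (n + v) =
               (\<Prod>i<r. (x (n + v) - int i) mod int p ^ (n + v)) mod int p ^ (n + v)"
      by (metis mod_diff_left_eq)
    then have "fact r * w (Suc n) mod int p ^ (n + v) = fact r * w n mod int p ^ (n + v)"
      by (simp add: w mod_prod_eq)
    then have "int p ^ (n + v) dvd fact r * (w (Suc n) - w n)"
      by (simp only: mod_eq_dvd_iff right_diff_distrib)
    then show "w (Suc n) mod int p ^ n = w n mod int p ^ n"
      unfolding mod_eq_dvd_iff by (rule cancel)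
  qed
  have b_eq: "padic_of_int p (fact r) \<otimes>\<^bsub>padic_int_ring p\<^esub> b = rhs"
  proof
    fix n
    have "(padic_of_int p (fact r) \<otimes>\<^bsub>padic_int_ring p\<^esub> b) n = fact r * w n mod int p ^ n"
      by (simp only: padic_of_int_eq[OF p0]) (simp add: padic_sel b_def mod_simps)
    also have "\<dots> = (\<Prod>i<r. (x (n + v) - int i) mod int p ^ n) mod int p ^ n"
      by (simp add: w mod_prod_eq)
    also have "\<dots> = (\<Prod>i<r. (x n - int i) mod int p ^ n) mod int p ^ n"
      using padic_mod_power[OF x, of n "n + v"] by (metis le_add1 mod_diff_left_eq)
    also have "\<dots> = rhs n" by (simp add: rhs mod_prod_eq)
    finally show "(padic_of_int p (fact r) \<otimes>\<^bsub>padic_int_ring p\<^esub> b) n = rhs n" .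
  qed
  have unique: "c = d"
    if c: "c \<in> carrier (padic_int_ring p)" and d: "d \<in> carrier (padic_int_ring p)"
      and eq: "padic_of_int p (fact r) \<otimes>\<^bsub>padic_int_ring p\<^esub> c =
               padic_of_int p (fact r) \<otimes>\<^bsub>padic_int_ring p\<^esub> d" for c d
  proof
    fix n
    have "fact r * c (n + v) mod int p ^ (n + v) = fact r * d (n + v) mod int p ^ (n + v)"
      using fun_cong[OF eq, of "n + v"]
      by (simp only: padic_of_int_eq[OF p0]) (simp add: padic_sel mod_simps)
    then have "int p ^ (n + v) dvd fact r * (c (n + v) - d (n + v))"
      by (simp only: mod_eq_dvd_iff right_diff_distrib)
    then have "c (n + v) mod int p ^ n = d (n + v) mod int p ^ n"
      unfolding mod_eq_dvd_iff by (rule cancel)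
    then show "c n = d n"
      by (simp add: padic_mod_power c d)
  qed
  show ?thesis
    unfolding rhs_def[symmetric] using b b_eq unique by metis
qed

end

theory Submission
  imports Defs "HOL-Number_Theory.Cong"
begin

text \<open>
  For \<open>r < p\<close> the number \<open>r!\<close> is a unit at \<open>p\<close>, so modulo \<open>p\<^sup>2\<close> the \<open>p\<close>-adic binomial
  coefficient depends only on \<open>x\<close> modulo \<open>p\<^sup>2\<close>, and \<open>x\<close> may be replaced by a natural number.
  The claim becomes that \<open>S(x) = \<Sum>r<p. (-1)\<^sup>r (x choose r)\<^sup>3\<close> is divisible by \<open>p\<^sup>2\<close>.

  Divisibility by \<open>p\<close> alone is a symmetry: modulo \<open>p\<close> one may take \<open>x = p - 2k\<close>, which is odd, and
  for odd \<open>n < p\<close> the terms \<open>r\<close> and \<open>n - r\<close> cancel (\<open>alt_cube_sum_odd_eq_0\<close>). This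
  works for all \<open>k\<close> with \<open>0 < 2k < p\<close>.

  The second factor \<open>p\<close> comes from the two-term recurrence behind Dixon's identity,
  \<open>(x + 2)\<^sup>2 S(x + 2) + 3 (3x + 2) (3x + 4) S(x) = boundary term\<close>. The creative telescoping
  certificate makes the boundary term, up to the factor \<open>(x + 1)\<^sup>3\<close>, a multiple of
  \<open>(x + 1 choose p - 1)\<^sup>3\<close> (\<open>alt_cube_sum_recurrence\<close>), which is divisible by \<open>p\<^sup>3\<close> in the relevant
  residue classes. So \<open>p\<^sup>2\<close> divides \<open>S(x + 2)\<close> as soon as it divides \<open>(3x + 2) (3x + 4) S(x)\<close>
  (\<open>prime_square_dvd_step\<close>). If \<open>x \<equiv> -2k\<close> with \<open>k\<close> equal to \<open>\<lfloor>(p - 1) / 3\<rfloor> + 1\<close>, one of \<open>3x + 2\<close> and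
  \<open>3x + 4\<close> is divisible by \<open>p\<close>, and \<open>S(x)\<close> supplies the other factor. This
  is the start of a downward induction on \<open>k\<close>, and it explains the bound on \<open>k\<close>.
\<close>

section \<open>A recurrence for the truncated alternating sum of cubes\<close>

definition alt_cube_sum :: "nat \<Rightarrow> nat \<Rightarrow> int" where
  "alt_cube_sum m x = (\<Sum>r<m. (-1) ^ r * int (x choose r) ^ 3)"

text \<open>
  The polynomial part of the rational certificate that Zeilberger's algorithm gives for the summand
  \<open>(-1)\<^sup>r (x choose r)\<^sup>3\<close>; it is the solution, of degree four in \<open>r\<close>, of the functional
  equation in \<open>cert_identity\<close>.
\<close>

definition cert :: "int \<Rightarrow> int \<Rightarrow> int" where
  "cert x r =
     28*x^5 + 220*x^4 + 682*x^3 + 1042*x^2 + 784*x + 232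
     - (78*x^4 + 483*x^3 + 1107*x^2 + 1113*x + 414) * r
     + (87*x^3 + 396*x^2 + 594*x + 294) * r^2
     - (45*x^2 + 132*x + 96) * r^3
     + (9*x + 12) * r^4"

lemma cert_identity:
  "(x + 1) ^ 3 * (x + 2) ^ 5 + 3 * (3 * x + 2) * (3 * x + 4) * ((x + 1 - r) * (x + 2 - r)) ^ 3 =
     cert x (r + 1) * (x + 2 - r) ^ 3 + cert x r * r ^ 3"
  unfolding cert_def by (simp add: algebra_simps eval_nat_numeral)

lemma binomial_lower_top:
  "(int n + 1) * int (n choose r) = (int n + 1 - int r) * int (Suc n choose r)"
proof (cases r)
  case (Suc s)
  have "int (Suc s) * int (Suc n choose Suc s) = int (Suc n) * int (n choose s)"
    using Suc_times_binomial[of s n] by (metis of_nat_mult)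
  moreover have "int (Suc n choose Suc s) = int (n choose s) + int (n choose Suc s)"
    by simp
  ultimately show ?thesis
    unfolding Suc by (simp add: algebra_simps)
qed simp

text \<open>
  The functional equation of the certificate, multiplied by \<open>c\<^sup>3\<close> and rewritten in terms of
  the binomial coefficients adjacent to \<open>c = (n + 2 choose r)\<close>: here \<open>u\<close>, \<open>v\<close> and \<open>w\<close> stand for
  \<open>(n + 1 choose r)\<close>, \<open>(n + 1 choose r - 1)\<close> and \<open>(n choose r)\<close>, each of which is a rational
  multiple of \<open>c\<close>. The identity is first proved with the additional factor \<open>(n + 2)\<^sup>3\<close> that clears
  these denominators.
\<close>

lemma cert_cubes:
  fixes n r c u v w :: int
  assumes u: "(n + 2) * u = (n + 2 - r) * c"
    and v: "(n + 2) * v = r * c"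
    and w: "(n + 2) * ((n + 1) * w) = (n + 1 - r) * ((n + 2 - r) * c)"
    and "n + 2 \<noteq> 0"
  shows "(n + 1) ^ 3 * ((n + 2) ^ 2 * c ^ 3 + 3 * (3 * n + 2) * (3 * n + 4) * w ^ 3) =
           cert n (r + 1) * u ^ 3 + cert n r * v ^ 3"
    (is "?L = ?R")
proof -
  define k where "k = 3 * (3 * n + 2) * (3 * n + 4)"
  have lhs: "b ^ 3 * (a ^ 3 * (b ^ 2 * c ^ 3 + k * w ^ 3)) =
      a ^ 3 * b ^ 5 * c ^ 3 + k * (b * (a * w)) ^ 3" for a b :: int
    by (simp add: power_mult_distrib algebra_simps flip: power_add)
  have factor: "a ^ 3 * b ^ 5 * c ^ 3 + k * (a' * (b' * c)) ^ 3 =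
      (a ^ 3 * b ^ 5 + k * (a' * b') ^ 3) * c ^ 3" for a b a' b' :: int
    by (simp add: power_mult_distrib algebra_simps flip: power_add)
  have rhs: "(q * b ^ 3 + q' * r ^ 3) * c ^ 3 = q * (b * c) ^ 3 + q' * (r * c) ^ 3" for q q' b :: int
    by (simp add: power_mult_distrib algebra_simps flip: power_add)
  have factor': "q * (b * u) ^ 3 + q' * (b * v) ^ 3 = b ^ 3 * (q * u ^ 3 + q' * v ^ 3)"
    for q q' b :: int
    by (simp add: power_mult_distrib algebra_simps flip: power_add)
  have "(n + 2) ^ 3 * ?L = (n + 2) ^ 3 * ?R"
    unfolding k_def[symmetric] lhs w factor cert_identity[of n r, folded k_def] rhs
    unfolding u[symmetric] v[symmetric]
    by (rule factor')
  then show ?thesis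
    using assms(4) by simp
qed

lemma binomial_cert:
  "(int x + 1) ^ 3 * ((int x + 2) ^ 2 * int (x + 2 choose Suc s) ^ 3
        + 3 * (3 * int x + 2) * (3 * int x + 4) * int (x choose Suc s) ^ 3) =
     cert (int x) (int s + 2) * int (x + 1 choose Suc s) ^ 3
        + cert (int x) (int s + 1) * int (x + 1 choose s) ^ 3"
proof -
  define n c r where "n = int x" and "c = int (x + 2 choose Suc s)" and "r = int s + 1"
  have u: "(n + 2) * int (x + 1 choose Suc s) = (n + 2 - r) * c"
    using binomial_lower_top[of "x + 1" "Suc s"] by (simp add: n_def c_def r_def algebra_simps)
  have v: "(n + 2) * int (x + 1 choose s) = r * c"
  proof -
    have "int (Suc s * (Suc (x + 1) choose Suc s)) = int (Suc (x + 1) * (x + 1 choose s))"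
      by (simp only: Suc_times_binomial)
    then show ?thesis
      unfolding of_nat_mult by (simp add: n_def c_def r_def algebra_simps)
  qed
  have "(n + 1) * int (x choose Suc s) = (n + 1 - r) * int (x + 1 choose Suc s)"
    using binomial_lower_top[of x "Suc s"] by (simp add: n_def r_def algebra_simps)
  then have "(n + 2) * ((n + 1) * int (x choose Suc s)) = (n + 1 - r) * ((n + 2 - r) * c)"
    using u by (simp only: mult.left_commute[of "n + 2" "n + 1 - r"])
  from cert_cubes[OF u v this] show ?thesis
    by (simp add: n_def c_def r_def add.assoc)
qed

text \<open>
  The two certificate terms in \<open>binomial_cert\<close> are shifts of each other in \<open>r\<close>, with equal sign;
  the factor \<open>(-1)\<^sup>r\<close> turns their sum into a difference, so the sum over \<open>r \<le> m\<close> telescopes and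
  only the top term remains.
\<close>

lemma alt_cube_sum_recurrence:
  "(int x + 1) ^ 3 * ((int x + 2) ^ 2 * alt_cube_sum (Suc m) (x + 2)
        + 3 * (3 * int x + 2) * (3 * int x + 4) * alt_cube_sum (Suc m) x) =
     (-1) ^ m * cert (int x) (int m + 1) * int (x + 1 choose m) ^ 3"
proof (induction m)
  case 0
  have "alt_cube_sum (Suc 0) y = 1" for y
    by (simp add: alt_cube_sum_def)
  moreover have "(n + 1) ^ 3 * ((n + 2) ^ 2 * 1 + 3 * (3 * n + 2) * (3 * n + 4) * 1) = cert n 1"
    for n :: int
    unfolding cert_def by (simp add: algebra_simps eval_nat_numeral)
  ultimately show ?case
    by (simp only: power_0 of_nat_0 add_0_left binomial_n_0 of_nat_1 power_one mult_1_left mult_1_right)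
next
  case (Suc m)
  define a b where "a = alt_cube_sum (Suc m) (x + 2)" and "b = alt_cube_sum (Suc m) x"
  define u v where "u = int (x + 2 choose Suc m)" and "v = int (x choose Suc m)"
  define e where "e = (-1 :: int) ^ m"
  have a: "alt_cube_sum (Suc (Suc m)) (x + 2) = a - e * u ^ 3"
    and b: "alt_cube_sum (Suc (Suc m)) x = b - e * v ^ 3"
    by (simp_all add: alt_cube_sum_def a_def b_def u_def v_def e_def)
  have s: "int (Suc m) + 1 = int m + 2" "(-1 :: int) ^ Suc m = - e"
    by (simp_all add: e_def)
  show ?case
  proof -
    define n A B K where "n = int x" and "A = (n + 2) ^ 2" and "B = 3 * (3 * n + 2) * (3 * n + 4)"
      and "K = (n + 1) ^ 3"
    have "K * (A * (a - e * u ^ 3) + B * (b - e * v ^ 3)) =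
        K * (A * a + B * b) - e * (K * (A * u ^ 3 + B * v ^ 3))"
      by (simp add: algebra_simps)
    also have "K * (A * a + B * b) = e * cert n (int m + 1) * int (x + 1 choose m) ^ 3"
      using Suc.IH by (simp only: a_def b_def e_def n_def A_def B_def K_def)
    also have "K * (A * u ^ 3 + B * v ^ 3) =
        cert n (int m + 2) * int (x + 1 choose Suc m) ^ 3
        + cert n (int m + 1) * int (x + 1 choose m) ^ 3"
      using binomial_cert[of x m] by (simp only: u_def v_def n_def A_def B_def K_def)
    finally have "K * (A * (a - e * u ^ 3) + B * (b - e * v ^ 3)) =
        - e * cert n (int m + 2) * int (x + 1 choose Suc m) ^ 3"
      by (simp add: algebra_simps)
    then show ?thesis
      unfolding a b s n_def A_def B_def K_def .
  qed
qed

lemma alt_cube_sum_odd_eq_0: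
  assumes "odd n" "n < m"
  shows "alt_cube_sum m n = 0"
proof -
  define f where "f r = (-1 :: int) ^ r * int (n choose r) ^ 3" for r
  have "alt_cube_sum m n = sum f {..n}"
    unfolding alt_cube_sum_def f_def
    by (rule sum.mono_neutral_right) (use assms(2) in \<open>auto simp: binomial_eq_0\<close>)
  moreover have "sum f {..n} = (\<Sum>r\<le>n. f (n - r))"
    by (rule sum.nat_diff_reindex[of f "Suc n", simplified lessThan_Suc_atMost, simplified, symmetric])
  moreover have "f (n - r) = - f r" if "r \<le> n" for r
  proof -
    have "(-1 :: int) ^ (n - r) = - ((-1) ^ r)"
      using assms(1) that by (simp add: minus_one_power_iff)
    then show ?thesis
      using binomial_symmetric[OF that] by (simp add: f_def)
  qed
  ultimately have "alt_cube_sum m n = - alt_cube_sum m n"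
    by (metis (no_types, lifting) atMost_iff sum.cong sum_negf)
  then show ?thesis by simp
qed

section \<open>Binomial coefficients modulo prime powers\<close>

lemma fact_mult_binomial_eq_prod:
  "fact r * int (y choose r) = (\<Prod>i<r. int y - int i)"
proof -
  have "real_of_int (fact r * int (y choose r)) = fact r * (real y gchoose r)"
    by (simp add: binomial_gbinomial)
  also have "\<dots> = real_of_int (\<Prod>i<r. int y - int i)"
    by (simp add: gbinomial_mult_fact atLeast0LessThan)
  finally show ?thesis
    by (simp only: of_int_eq_iff)
qed

text \<open>
  Since \<open>r!\<close> is a unit modulo \<open>m\<close>, the falling factorial determines the binomial coefficient
  modulo \<open>m\<close>. This is used both with \<open>b\<close> an ordinary binomial coefficient (to replace its upper
  entry by a congruent one) and with \<open>b\<close> a component of a \<open>p\<close>-adic one.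
\<close>

lemma binomial_cong_falling:
  assumes "coprime (fact r) m"
    and "[fact r * b = (\<Prod>i<r. z - int i)] (mod m)"
    and "[z = int y] (mod m)"
  shows "[b = int (y choose r)] (mod m)"
proof -
  have "[(\<Prod>i<r. z - int i) = (\<Prod>i<r. int y - int i)] (mod m)"
    by (intro cong_prod cong_diff assms(3) cong_refl)
  with assms(2) have "[fact r * b = fact r * int (y choose r)] (mod m)"
    unfolding fact_mult_binomial_eq_prod by (rule cong_trans)
  with assms(1) show ?thesis
    using cong_mult_lcancel by blast
qed

lemma coprime_fact_prime_power:
  assumes "prime p" "r < p"
  shows "coprime (fact r) (int p ^ n)"
proof -
  have "\<not> int p dvd fact r"
    using prime_dvd_fact_iff[OF assms(1), of r] assms(2)
    by (metis int_dvd_int_iff linorder_not_le of_nat_fact)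
  then have "coprime (fact r) (int p)"
    using assms(1) by (metis coprime_commute prime_imp_coprime prime_nat_int_transfer)
  then show ?thesis by simp
qed

section \<open>Divisibility of the sum by a prime and by its square\<close>

lemma alt_cube_sum_cong:
  assumes "\<And>r. r < m \<Longrightarrow> [f r = int (y choose r)] (mod d)"
  shows "[(\<Sum>r<m. (-1) ^ r * f r ^ 3) = alt_cube_sum m y] (mod d)"
  unfolding alt_cube_sum_def
  by (intro cong_sum cong_mult cong_pow cong_refl assms) simp

lemma binomial_cong_mod_prime:
  assumes "prime p" "r < p" "[int x = int y] (mod int p)"
  shows "[int (x choose r) = int (y choose r)] (mod int p)"
proof (rule binomial_cong_falling)
  show "coprime (fact r) (int p)"
    using coprime_fact_prime_power[OF assms(1,2), of 1] by simp
  show "[fact r * int (x choose r) = (\<Prod>i<r. int x - int i)] (mod int p)"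
    by (simp add: fact_mult_binomial_eq_prod)
qed (use assms in simp)

lemma prime_dvd_alt_cube_sum:
  assumes "prime p" "odd p" "1 \<le> k" "2 * k < p" "[int x = - 2 * int k] (mod int p)"
  shows "int p dvd alt_cube_sum p x"
proof -
  define n where "n = p - 2 * k"
  have n: "odd n" "n < p" "int n = - 2 * int k + int p"
    using assms(2-4) by (auto simp: n_def)
  have "[int x = int n] (mod int p)"
    using assms(5) n(3) by (simp add: cong_def)
  then have "[alt_cube_sum p x = alt_cube_sum p n] (mod int p)"
    unfolding alt_cube_sum_def[of p x]
    by (intro alt_cube_sum_cong binomial_cong_mod_prime assms(1))
  then show ?thesis
    using alt_cube_sum_odd_eq_0[OF n(1,2)] by (simp add: cong_0_iff)
qed

lemma prime_not_dvd_of_cong: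
  assumes "[a = - int c] (mod int p)" "0 < c" "c < p"
  shows "\<not> int p dvd a"
proof -
  have "int p dvd a \<longleftrightarrow> int p dvd int c"
    using cong_dvd_iff[of a "- int c" "int p"] cong_dvd_modulus assms(1)
    by (metis cong_0_iff cong_sym cong_trans dvd_minus_iff)
  then show ?thesis
    using assms(2,3) by (simp add: nat_dvd_not_less)
qed

text \<open>
  For \<open>x \<equiv> -2k\<close> with \<open>2 \<le> k\<close> and \<open>2k < p\<close> the factors \<open>x + 1\<close> and \<open>x + 2\<close> of the recurrence are
  units at \<open>p\<close>. The residue of \<open>x + 1\<close> is \<open>p + 1 - 2k < p - 1\<close>, hence \<open>p\<close> divides
  \<open>(x + 1 choose p - 1)\<close> and its cube disappears modulo \<open>p\<^sup>2\<close>. (For \<open>k = 1\<close> this fails, as does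
  the invertibility of \<open>x + 2\<close>; the induction stops there.)
\<close>

lemma prime_square_dvd_step:
  assumes p: "prime p" and k: "2 \<le> k" "2 * k < p"
    and x: "[int x = - 2 * int k] (mod int p)"
    and prev: "int p ^ 2 dvd (3 * int x + 2) * (3 * int x + 4) * alt_cube_sum p x"
  shows "int p ^ 2 dvd alt_cube_sum p (x + 2)"
proof -
  have p': "prime (int p)" "Suc (p - 1) = p"
    using p prime_gt_0_nat[of p] by auto
  have x1: "[int x + 1 = - int (2 * k - 1)] (mod int p)"
    using cong_add[OF x cong_refl[of 1]] k by (simp add: of_nat_diff algebra_simps)
  have x2: "[int x + 2 = - int (2 * k - 2)] (mod int p)"
    using cong_add[OF x cong_refl[of 2]] k by (simp add: of_nat_diff algebra_simps)
  have nd: "\<not> int p dvd int x + 1" "\<not> int p dvd int x + 2"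
    using prime_not_dvd_of_cong[OF x1] prime_not_dvd_of_cong[OF x2] k by auto
  \<comment> \<open>The boundary term: \<open>x + 1\<close> has a residue too small for \<open>p - 1\<close> to be chosen from.\<close>
  define y where "y = p + 1 - 2 * k"
  have y: "int y = - int (2 * k - 1) + int p" "y < p - 1"
    using k by (auto simp: y_def)
  have "[int (x + 1) = int y] (mod int p)"
    using x1 y(1) by (simp add: cong_def add.commute)
  then have "[int (x + 1 choose (p - 1)) = int (y choose (p - 1))] (mod int p)"
    using p' by (intro binomial_cong_mod_prime p) auto
  then have "int p dvd int (x + 1 choose (p - 1))"
    using y(2) by (simp add: binomial_eq_0 cong_0_iff)
  then have "int p ^ 3 dvd int (x + 1 choose (p - 1)) ^ 3"
    by (rule dvd_power_same)
  then have "int p ^ 2 dvd int (x + 1 choose (p - 1)) ^ 3"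
    by (rule dvd_trans[rotated]) (simp add: le_imp_power_dvd)
  then have "int p ^ 2 dvd (int x + 1) ^ 3 * ((int x + 2) ^ 2 * alt_cube_sum p (x + 2)
        + 3 * (3 * int x + 2) * (3 * int x + 4) * alt_cube_sum p x)"
    using alt_cube_sum_recurrence[of x "p - 1"] p'(2) by simp
  then have "int p ^ 2 dvd (int x + 2) ^ 2 * alt_cube_sum p (x + 2)
        + 3 * ((3 * int x + 2) * (3 * int x + 4) * alt_cube_sum p x)"
    using nd(1) p'(1)
    by (metis (no_types, lifting) coprime_commute coprime_dvd_mult_right_iff
        coprime_power_left_iff coprime_power_right_iff prime_imp_coprime mult.assoc)
  then have "int p ^ 2 dvd (int x + 2) ^ 2 * alt_cube_sum p (x + 2)"
    using prev by (metis dvd_add_left_iff dvd_mult)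
  then show ?thesis
    using nd(2) p'(1)
    by (metis coprime_commute coprime_dvd_mult_right_iff
        coprime_power_left_iff coprime_power_right_iff prime_imp_coprime)
qed

text \<open>
  The recurrence runs over natural numbers, so going from \<open>x \<equiv> -2k\<close> to \<open>x - 2 \<equiv> -2(k + 1)\<close> requires
  \<open>x \<ge> 2\<close>; this holds because the residue of \<open>x\<close> is already \<open>p - 2k \<ge> 2\<close>.
\<close>

lemma congruent_nat_sub_2:
  assumes "1 \<le> k" "2 * k + 2 \<le> p" "[int x = - 2 * int k] (mod int p)"
  obtains y where "x = y + 2" "[int y = - 2 * int (Suc k)] (mod int p)"
proof
  define n where "n = p - 2 * k"
  have n: "int n = - 2 * int k + int p" "2 \<le> n" "n < p"
    using assms(1,2) by (auto simp: n_def)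
  have "[int x = int n] (mod int p)"
    using assms(3) n(1) by (simp add: cong_def)
  then have "x mod p = n"
    using n(3) unfolding cong_int_iff by (simp add: cong_def)
  then have "2 \<le> x"
    using n(2) mod_less_eq_dividend[of x p] by linarith
  then show "x = (x - 2) + 2" by simp
  have "int (x - 2) = int x - 2" "- 2 * int (Suc k) = - 2 * int k - 2"
    using \<open>2 \<le> x\<close> by simp_all
  then show "[int (x - 2) = - 2 * int (Suc k)] (mod int p)"
    using cong_diff[OF assms(3) cong_refl[of 2]] by (simp only:)
qed

lemma prime_square_dvd_alt_cube_sum:
  assumes p: "prime p" "p > 3" and k: "1 \<le> k" "k \<le> (p - 1) div 3"
    and x: "[int x = - 2 * int k] (mod int p)"
  shows "int p ^ 2 dvd alt_cube_sum p x"
proof -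
  have odd: "odd p" using p prime_odd_nat[of p] by simp
  have not3: "p mod 3 \<noteq> 0"
    using p primes_dvd_imp_eq[of 3 p] by (auto simp: dvd_eq_mod_eq_0)
  show ?thesis
    using k(2,1) x
  proof (induction k arbitrary: x rule: inc_induct)
    case base
    define m where "m = (p - 1) div 3"
    have m: "p = 3 * m + 1 \<or> p = 3 * m + 2" "m \<ge> 1"
      using not3 p(2) unfolding m_def by presburger+
    have bounds: "2 * m + 2 \<le> p" "2 * Suc m < p"
      using m odd p(2) by auto presburger+
    obtain y where y: "x = y + 2" "[int y = - 2 * int (Suc m)] (mod int p)"
      using congruent_nat_sub_2[of m p x] base bounds m(2) unfolding m_def by blast
    have "int p dvd int y - (- 2 * int (Suc m))"
      using y(2) by (simp only: cong_iff_dvd_diff)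
    then have "int p dvd 3 * (int y - (- 2 * int (Suc m)))"
      by (rule dvd_mult)
    then have *: "int p dvd 3 * int y + 6 * int (Suc m)"
      by (simp add: algebra_simps)
    \<comment> \<open>\<open>3 y \<equiv> -6 (m + 1)\<close>, and \<open>3 (m + 1)\<close> is \<open>p + 2\<close> or \<open>p + 1\<close>, so \<open>3 y\<close> is \<open>-4\<close> or \<open>-2\<close> modulo \<open>p\<close>.\<close>
    have "int p dvd (3 * int y + 2) * (3 * int y + 4)"
      using m(1)
    proof
      assume "p = 3 * m + 1"
      then have "3 * int y + 6 * int (Suc m) = (3 * int y + 4) + 2 * int p" by simp
      with * have "int p dvd 3 * int y + 4"
        by (metis dvd_add_left_iff dvd_triv_right)
      then show ?thesis by simp
    next
      assume "p = 3 * m + 2"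
      then have "3 * int y + 6 * int (Suc m) = (3 * int y + 2) + 2 * int p" by simp
      with * have "int p dvd 3 * int y + 2"
        by (metis dvd_add_left_iff dvd_triv_right)
      then show ?thesis by simp
    qed
    moreover have "int p dvd alt_cube_sum p y"
      by (rule prime_dvd_alt_cube_sum[OF p(1) odd _ bounds(2) y(2)]) simp
    ultimately have "int p ^ 2 dvd (3 * int y + 2) * (3 * int y + 4) * alt_cube_sum p y"
      unfolding power2_eq_square by (rule mult_dvd_mono)
    then show ?case
      using prime_square_dvd_step[OF p(1) _ bounds(2) y(2)] m(2) y(1) by simp
  next
    case (step k)
    have bounds: "2 * k + 2 \<le> p" "2 * Suc k < p"
      using step.hyps p(2) by auto
    obtain y where y: "x = y + 2" "[int y = - 2 * int (Suc k)] (mod int p)"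
      using congruent_nat_sub_2[of k p x] step.prems bounds by blast
    have "int p ^ 2 dvd alt_cube_sum p y"
      using step.IH[of y] y(2) by simp
    then show ?case
      using prime_square_dvd_step[OF p(1) _ bounds(2) y(2)] step.prems(1) y(1) by simp
  qed
qed

section \<open>Congruences of \<open>p\<close>-adic integers through their components\<close>

text \<open>
  If the component modulo \<open>p\<^sup>m\<close> vanishes, all later components are divisible by \<open>p\<^sup>m\<close>; the
  quotient has as its component modulo \<open>p\<^sup>n\<close> the exact quotient of the component modulo
  \<open>p\<close> to the power \<open>n + m\<close>, because the division loses \<open>m\<close> digits.
\<close>

lemma padic_cong_zeroI:
  assumes p: "p > 0" and a: "a \<in> carrier (padic_int_ring p)" and "a m = 0"
  shows "padic_cong p (int p ^ m) a \<zero>\<^bsub>padic_int_ring p\<^esub>"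
proof -
  interpret cring "padic_int_ring p" by (rule padic_cring) fact
  have pow: "int p ^ n > 0" for n using p by simp
  define b where "b n = a (n + m) div int p ^ m" for n
  have ab: "a (n + m) = int p ^ m * b n" for n
  proof -
    have "a (n + m) mod int p ^ m = 0"
      using padic_mod_power[OF a, of m "n + m"] assms(3) by simp
    then show ?thesis unfolding b_def by auto
  qed
  have "b \<in> carrier (padic_int_ring p)"
    unfolding padic_carrier_iff
  proof (intro allI conjI)
    fix n
    have range: "0 \<le> a (n + m)" "a (n + m) < int p ^ (n + m)"
      using a by (simp_all add: padic_carrier_iff)
    show "0 \<le> b n"
      using range(1) pow[of m] by (simp add: b_def pos_imp_zdiv_nonneg_iff)
    have "int p ^ m * b n < int p ^ m * int p ^ n"
      using range(2) unfolding ab by (simp only: power_add mult.commute)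
    then show "b n < int p ^ n"
      using pow[of m] by simp
    have "int p ^ m * b (Suc n) mod (int p ^ m * int p ^ n) = int p ^ m * b n"
      using a unfolding padic_carrier_iff ab[symmetric]
      by (metis add_Suc power_add mult.commute)
    then show "b (Suc n) mod int p ^ n = b n"
      using p by (simp flip: mult_mod_right)
  qed
  moreover have "a = padic_of_int p (int p ^ m) \<otimes>\<^bsub>padic_int_ring p\<^esub> b"
  proof
    fix n
    have "a n = a (n + m) mod int p ^ n"
      using padic_mod_power[OF a, of n "n + m"] by simp
    also have "\<dots> = (padic_of_int p (int p ^ m) \<otimes>\<^bsub>padic_int_ring p\<^esub> b) n"
      by (simp only: padic_of_int_eq[OF p] ab) (simp add: padic_sel mod_simps)
    finally show "a n = (padic_of_int p (int p ^ m) \<otimes>\<^bsub>padic_int_ring p\<^esub> b) n" .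
  qed
  moreover have "a \<ominus>\<^bsub>padic_int_ring p\<^esub> \<zero>\<^bsub>padic_int_ring p\<^esub> = a"
    using a by (simp add: a_minus_def)
  ultimately show ?thesis
    unfolding padic_cong_def factor_def by auto
qed

lemma padic_congD:
  assumes p: "p > 0" and a: "a \<in> carrier (padic_int_ring p)" "b \<in> carrier (padic_int_ring p)"
    and "padic_cong p (int p ^ m) a b"
  shows "a m = b m"
proof -
  obtain c where c: "a \<ominus>\<^bsub>padic_int_ring p\<^esub> b = padic_of_int p (int p ^ m) \<otimes>\<^bsub>padic_int_ring p\<^esub> c"
    using assms(4) unfolding padic_cong_def factor_def by blast
  have "(padic_of_int p (int p ^ m) \<otimes>\<^bsub>padic_int_ring p\<^esub> c) m = 0"
    by (simp only: padic_of_int_eq[OF p]) (simp add: padic_sel)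
  then have "(a m - b m) mod int p ^ m = 0"
    using fun_cong[OF c, of m] by (simp only: padic_minus[OF p a])
  then have "a m mod int p ^ m = b m mod int p ^ m"
    by (simp add: mod_eq_dvd_iff dvd_eq_mod_eq_0)
  then show ?thesis
    by (simp add: padic_mod_self a)
qed

lemma padic_binom_closed:
  assumes "prime p" "x \<in> carrier (padic_int_ring p)"
  shows "padic_binom p x r \<in> carrier (padic_int_ring p)"
  using theI'[OF padic_binom_ex1[OF assms]] unfolding padic_binom_def by blast

lemma padic_binom_cong:
  assumes p: "prime p" and x: "x \<in> carrier (padic_int_ring p)" and "r < p"
    and y: "[x n = int y] (mod int p ^ n)"
  shows "[padic_binom p x r n = int (y choose r)] (mod int p ^ n)"
proof (rule binomial_cong_falling[OF coprime_fact_prime_power[OF p \<open>r < p\<close>] _ y])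
  have p0: "p > 0" using p by (simp add: prime_gt_0_nat)
  interpret cring "padic_int_ring p" by (rule padic_cring) fact
  define rhs where
    "rhs = (\<Otimes>\<^bsub>padic_int_ring p\<^esub>i\<in>{..<r}. x \<ominus>\<^bsub>padic_int_ring p\<^esub> padic_of_int p (int i))"
  have "padic_of_int p (fact r) \<otimes>\<^bsub>padic_int_ring p\<^esub> padic_binom p x r = rhs"
    using theI'[OF padic_binom_ex1[OF p x]] unfolding padic_binom_def rhs_def by blast
  moreover have "(padic_of_int p (fact r) \<otimes>\<^bsub>padic_int_ring p\<^esub> padic_binom p x r) n =
      fact r * padic_binom p x r n mod int p ^ n"
    by (simp only: padic_of_int_eq[OF p0]) (simp add: padic_sel mod_simps)
  moreover have "rhs n = (\<Prod>i<r. (x \<ominus>\<^bsub>padic_int_ring p\<^esub> padic_of_int p (int i)) n) mod int p ^ n"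
    unfolding rhs_def by (subst padic_finprod[OF p0]) (use x in auto)
  moreover have "(x \<ominus>\<^bsub>padic_int_ring p\<^esub> padic_of_int p (int i)) n = (x n - int i) mod int p ^ n" for i
    using x by (simp add: padic_minus p0) (simp add: padic_of_int_eq p0 mod_simps)
  ultimately have "fact r * padic_binom p x r n mod int p ^ n =
      (\<Prod>i<r. (x n - int i) mod int p ^ n) mod int p ^ n"
    by simp
  then show "[fact r * padic_binom p x r n = (\<Prod>i<r. x n - int i)] (mod int p ^ n)"
    by (simp add: cong_def mod_prod_eq)
qed

lemma padic_finsum:
  assumes "p > 0" "finite A" "\<And>i. i \<in> A \<Longrightarrow> f i \<in> carrier (padic_int_ring p)"
  shows "finsum (padic_int_ring p) f A = (\<lambda>n. (\<Sum>i\<in>A. f i n) mod int p ^ n)"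
proof -
  interpret cring "padic_int_ring p" by (rule padic_cring) fact
  show ?thesis
    using assms(2,3)
  proof (induction A rule: finite_induct)
    case empty
    show ?case by (simp add: padic_sel)
  next
    case (insert a A)
    then have "finsum (padic_int_ring p) f (insert a A) =
        f a \<oplus>\<^bsub>padic_int_ring p\<^esub> finsum (padic_int_ring p) f A"
      by (intro finsum_insert) auto
    with insert show ?case by (simp add: padic_sel mod_simps)
  qed
qed

lemma padic_pow:
  assumes "p > 0" "f \<in> carrier (padic_int_ring p)"
  shows "f [^]\<^bsub>padic_int_ring p\<^esub> (r :: nat) = (\<lambda>n. f n ^ r mod int p ^ n)"
proof -
  interpret cring "padic_int_ring p" by (rule padic_cring) fact
  show ?thesis
    by (induction r) (simp_all add: padic_sel mod_simps mult.commute)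
qed

theorem theorem1p3:
  fixes p k :: nat and x :: "nat \<Rightarrow> int"
  assumes "prime p" and "p > 3"
    and "x \<in> carrier (padic_int_ring p)"
    and "k \<in> {1..(p - 1) div 3}"
    and "padic_cong p (int p) x (padic_of_int p (- 2 * int k))"
  shows "padic_cong p (int p ^ 2)
           (\<Oplus>\<^bsub>padic_int_ring p\<^esub>r\<in>{0..p - 1}.
              (\<ominus>\<^bsub>padic_int_ring p\<^esub> \<one>\<^bsub>padic_int_ring p\<^esub>) [^]\<^bsub>padic_int_ring p\<^esub> r
              \<otimes>\<^bsub>padic_int_ring p\<^esub> padic_binom p x r [^]\<^bsub>padic_int_ring p\<^esub> (3::nat))
           \<zero>\<^bsub>padic_int_ring p\<^esub>"
proof -
  have p0: "p > 0" using assms(2) by simp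
  interpret cring "padic_int_ring p" by (rule padic_cring) fact
  define f where "f r = (\<ominus>\<^bsub>padic_int_ring p\<^esub> \<one>\<^bsub>padic_int_ring p\<^esub>) [^]\<^bsub>padic_int_ring p\<^esub> r
      \<otimes>\<^bsub>padic_int_ring p\<^esub> padic_binom p x r [^]\<^bsub>padic_int_ring p\<^esub> (3::nat)" for r :: nat
  have closed: "padic_binom p x r \<in> carrier (padic_int_ring p)" for r
    by (rule padic_binom_closed[OF assms(1,3)])
  then have f: "f r \<in> carrier (padic_int_ring p)" for r
    by (simp add: f_def)
  have "\<ominus>\<^bsub>padic_int_ring p\<^esub> \<one>\<^bsub>padic_int_ring p\<^esub> =
      \<zero>\<^bsub>padic_int_ring p\<^esub> \<ominus>\<^bsub>padic_int_ring p\<^esub> \<one>\<^bsub>padic_int_ring p\<^esub>"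
    by (simp add: a_minus_def)
  also have "\<dots> = (\<lambda>n. (- 1) mod int p ^ n)"
    using padic_minus[OF p0 zero_closed one_closed] by (simp add: padic_sel mod_simps)
  finally have m1: "\<ominus>\<^bsub>padic_int_ring p\<^esub> \<one>\<^bsub>padic_int_ring p\<^esub> = (\<lambda>n. (- 1) mod int p ^ n)" .
  have f_eq: "f r n = (-1) ^ r * padic_binom p x r n ^ 3 mod int p ^ n" for r n
    unfolding f_def padic_pow[OF p0 closed] padic_pow[OF p0 a_inv_closed[OF one_closed]]
    unfolding m1
    by (simp add: padic_sel mod_simps)
  define y where "y = nat (x 2)"
  have y: "x 2 = int y"
    using assms(3) by (simp add: y_def padic_carrier_iff)
  have "x 1 = (- 2 * int k) mod int p"
  proof -
    have "x 1 = padic_of_int p (- 2 * int k) 1"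
      using assms(5) by (intro padic_congD[OF p0 assms(3)]) simp_all
    then show ?thesis by (simp only: padic_of_int_eq[OF p0]) simp
  qed
  moreover have "x 2 mod int p = x 1"
    using padic_mod_power[OF assms(3), of 1 2] by simp
  ultimately have "[int y = - 2 * int k] (mod int p)"
    by (simp add: y cong_def)
  then have dvd: "int p ^ 2 dvd alt_cube_sum p y"
    using prime_square_dvd_alt_cube_sum[of p k y] assms(1,2,4) by simp
  have set: "{0..p - 1} = {..<p}" using p0 by auto
  have "finsum (padic_int_ring p) f {0..p - 1} 2 =
      (\<Sum>r<p. (-1) ^ r * padic_binom p x r 2 ^ 3) mod int p ^ 2"
    unfolding set by (subst padic_finsum[OF p0]) (simp_all add: f f_eq mod_sum_eq)
  also have "\<dots> = alt_cube_sum p y mod int p ^ 2"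
    using alt_cube_sum_cong[of p "\<lambda>r. padic_binom p x r 2" y "int p ^ 2"]
      padic_binom_cong[OF assms(1,3), of _ 2 y] y by (simp add: cong_def)
  also have "\<dots> = 0" using dvd by simp
  finally have "finsum (padic_int_ring p) f {0..p - 1} 2 = 0" .
  then show ?thesis
    unfolding f_def[symmetric] by (intro padic_cong_zeroI p0 finsum_closed) (simp_all add: f)
qed

end
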